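(* For any positive integer $q$, there exists a constant $c_q>0$, depending only on $q$, such that for any positive integer $N$, any real numbers $\varphi_1,\ldots,\varphi_N$, any non-negative real numbers $a_1,\ldots,a_N$, and any real $T>0$, $$c_q\Big(\sum_{n=1}^N a_n^2\Big)^q \le \frac{1}{2T}\int_{|t|\le T}\Big|\sum_{n=1}^N a_n e^{it\varphi_n}\Big|^{2q}\,dt.$$
   Context: Here $t$ is a real variable, $i$ is the imaginary unit, and the integral is the Lebesgue integral over $[-T,T]$. *)

theory Defs
  imports "HOL-Analysis.Analysis"
begin

end

theory Submission
  imports Defs
begin

text \<open>
  Convexity of the \<open>q\<close>-th power reduces the claim to the mean of \<open>\<bar>F\<bar>\<^sup>2\<close>, where
  \<open>F\<close> is the exponential sum. Minorising the indicator function of \<open>[-T, T]\<close> by the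
  triangle function \<open>1 - \<bar>t\<bar> / T\<close>, whose Fourier transform is non-negative (Fejer kernel), and
  expanding the square, the off-diagonal terms may be dropped because \<open>a\<^sub>n a\<^sub>m \<ge> 0\<close>, and the
  diagonal contributes \<open>T \<Sum> a\<^sub>n\<^sup>2\<close>. This gives the constant \<open>2\<^sup>-\<^sup>q\<close>.
\<close>

text \<open>The graph of a convex power lies above its tangent line at \<open>y\<close>. In the
  induction, multiplying the bound for \<open>k\<close> by \<open>x\<close> exceeds the next tangent
  line by exactly \<open>Suc k * y ^ k * (x - y)\<^sup>2\<close>.\<close>

lemma power_ge_tangent:
  fixes x y :: real
  assumes "x \<ge> 0" "y \<ge> 0"
  shows "y ^ Suc k + real (Suc k) * y ^ k * (x - y) \<le> x ^ Suc k"
proof (induction k)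
  case 0
  show ?case by simp
next
  case (Suc k)
  have "0 \<le> real (Suc k) * y ^ k * (x - y)\<^sup>2"
    using assms by simp
  also have "\<dots> = x * (y ^ Suc k + real (Suc k) * y ^ k * (x - y))
      - (y ^ Suc (Suc k) + real (Suc (Suc k)) * y ^ Suc k * (x - y))"
    by (simp add: algebra_simps power2_eq_square)
  also have "x * (y ^ Suc k + real (Suc k) * y ^ k * (x - y)) \<le> x * x ^ Suc k"
    using Suc assms by (intro mult_left_mono)
  finally show ?case by simp
qed

lemma has_integral_triangle_cos_half:
  fixes T u :: real
  assumes "T > 0"
  shows "((\<lambda>t. (1 - t / T) * cos (u * t)) has_integral
           (if u = 0 then T / 2 else (1 - cos (u * T)) / (u\<^sup>2 * T))) {0..T}"
proof (cases "u = 0")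
  case True
  have "((\<lambda>t. 1 - t / T) has_integral (T - T\<^sup>2 / (2 * T)) - (0 - 0\<^sup>2 / (2 * T))) {0..T}"
    using assms
    by (intro fundamental_theorem_of_calculus)
       (auto intro!: derivative_eq_intros
             simp flip: has_real_derivative_iff_has_vector_derivative simp: field_simps)
  then show ?thesis
    using True assms by (simp add: power2_eq_square)
next
  case False
  \<comment> \<open>Antiderivative from integration by parts: the two sine terms in its derivative
    cancel.\<close>
  let ?G = "\<lambda>t. (1 - t / T) * (sin (u * t) / u) - cos (u * t) / (u\<^sup>2 * T)"
  have "((\<lambda>t. (1 - t / T) * cos (u * t)) has_integral ?G T - ?G 0) {0..T}"
    using assms False
    by (intro fundamental_theorem_of_calculus)
       (auto intro!: derivative_eq_intros
             simp flip: has_real_derivative_iff_has_vector_derivative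
             simp: field_simps power2_eq_square)
  then show ?thesis
    using False assms by (simp add: diff_divide_distrib)
qed

text \<open>The integrand is even, so reflection doubles the integral over the half interval. The
  value is non-negative because cosine is at most 1.\<close>

lemma has_integral_triangle_cos:
  fixes T u :: real
  assumes "T > 0"
  shows "((\<lambda>t. (1 - \<bar>t\<bar> / T) * cos (u * t)) has_integral
           (if u = 0 then T else 2 * (1 - cos (u * T)) / (u\<^sup>2 * T))) {-T..T}"
proof -
  let ?f = "\<lambda>t. (1 - \<bar>t\<bar> / T) * cos (u * t)"
  let ?I = "if u = 0 then T / 2 else (1 - cos (u * T)) / (u\<^sup>2 * T)"
  have pos: "(?f has_integral ?I) {0..T}"
    by (rule has_integral_eq[OF _ has_integral_triangle_cos_half[OF assms]]) simp
  then have "(?f has_integral ?I) {-T..0}"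
    using has_integral_reflect_real[of ?f ?I T 0] by simp
  from has_integral_combine[OF _ _ this pos] assms show ?thesis
    by (simp split: if_splits)
qed

text \<open>Squaring the real and imaginary parts gives double sums of products of cosines and of
  sines, which merge by the formula for the cosine of a difference.\<close>

lemma norm_exp_sum_square:
  fixes a \<phi> :: "nat \<Rightarrow> real"
  shows "(cmod (\<Sum>n\<in>A. complex_of_real (a n) * exp (\<i> * complex_of_real t * complex_of_real (\<phi> n))))\<^sup>2
     = (\<Sum>n\<in>A. \<Sum>m\<in>A. a n * a m * cos ((\<phi> n - \<phi> m) * t))"
proof -
  have "(\<Sum>n\<in>A. complex_of_real (a n) * exp (\<i> * complex_of_real t * complex_of_real (\<phi> n)))
      = Complex (\<Sum>n\<in>A. a n * cos (t * \<phi> n)) (\<Sum>n\<in>A. a n * sin (t * \<phi> n))"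
    by (simp add: complex_eq_iff Re_exp Im_exp)
  then show ?thesis
    by (simp only: cmod_power2 complex.sel)
       (simp add: power2_eq_square sum_product cos_diff algebra_simps flip: sum.distrib)
qed

lemma integral_norm_exp_sum_square_ge:
  fixes a \<phi> :: "nat \<Rightarrow> real"
  assumes "finite A" "\<And>n. n \<in> A \<Longrightarrow> a n \<ge> 0" "T > 0"
  shows "T * (\<Sum>n\<in>A. (a n)\<^sup>2) \<le> integral {-T..T}
     (\<lambda>t. (cmod (\<Sum>n\<in>A. complex_of_real (a n) * exp (\<i> * complex_of_real t * complex_of_real (\<phi> n))))\<^sup>2)"
    (is "_ \<le> integral _ ?f")
proof -
  \<comment> \<open>The Fourier transform of the triangle function; its value at 0 is the area
    \<open>T\<close>.\<close>
  define K where "K u = (if u = 0 then T else 2 * (1 - cos (u * T)) / (u\<^sup>2 * T))" for u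
  have K_nonneg: "K u \<ge> 0" for u
    using assms(3) by (simp add: K_def)
  have "((\<lambda>t. \<Sum>n\<in>A. \<Sum>m\<in>A. a n * a m * ((1 - \<bar>t\<bar> / T) * cos ((\<phi> n - \<phi> m) * t))) has_integral
      (\<Sum>n\<in>A. \<Sum>m\<in>A. a n * a m * K (\<phi> n - \<phi> m))) {-T..T}"
    unfolding K_def
    by (intro has_integral_sum has_integral_mult_right has_integral_triangle_cos assms)
  moreover have "(\<Sum>n\<in>A. \<Sum>m\<in>A. a n * a m * ((1 - \<bar>t\<bar> / T) * cos ((\<phi> n - \<phi> m) * t)))
      = (1 - \<bar>t\<bar> / T) * ?f t" for t
    unfolding norm_exp_sum_square by (simp add: sum_distrib_left mult_ac)
  ultimately have int: "((\<lambda>t. (1 - \<bar>t\<bar> / T) * ?f t) has_integral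
      (\<Sum>n\<in>A. \<Sum>m\<in>A. a n * a m * K (\<phi> n - \<phi> m))) {-T..T}"
    by simp
  have "T * (\<Sum>n\<in>A. (a n)\<^sup>2) = (\<Sum>n\<in>A. a n * a n * K (\<phi> n - \<phi> n))"
    by (simp add: K_def sum_distrib_left power2_eq_square mult_ac)
  also have "\<dots> \<le> (\<Sum>n\<in>A. \<Sum>m\<in>A. a n * a m * K (\<phi> n - \<phi> m))"
    \<comment> \<open>For each \<open>n\<close>, the inner sum of non-negative terms is at least its
      term \<open>m = n\<close>.\<close>
    using assms K_nonneg by (intro sum_mono member_le_sum) auto
  also have "\<dots> \<le> integral {-T..T} ?f"
  proof (rule has_integral_le[OF int integrable_integral])
    show "?f integrable_on {-T..T}"
      by (intro integrable_continuous_real continuous_intros)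
    show "(1 - \<bar>t\<bar> / T) * ?f t \<le> ?f t" if "t \<in> {-T..T}" for t
      using assms(3) that by (intro mult_left_le_one_le) (auto simp: field_simps)
  qed
  finally show ?thesis .
qed

theorem theorem1:
  fixes q :: nat
  assumes "q \<ge> 1"
  shows "\<exists>c::real. c > 0 \<and>
    (\<forall>(N::nat) (\<phi>::nat \<Rightarrow> real) (a::nat \<Rightarrow> real) (T::real).
      N \<ge> 1 \<longrightarrow> (\<forall>n\<in>{1..N}. a n \<ge> 0) \<longrightarrow> T > 0 \<longrightarrow>
      c * (\<Sum>n=1..N. (a n)\<^sup>2) ^ q
        \<le> 1 / (2 * T) *
          (LINT t:{-T..T}|lborel.
            (cmod (\<Sum>n=1..N. complex_of_real (a n) * exp (\<i> * complex_of_real t * complex_of_real (\<phi> n)))) ^ (2 * q)))"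
proof (intro exI[of _ "(1 / 2) ^ q"] conjI allI impI)
  fix N :: nat and \<phi> a :: "nat \<Rightarrow> real" and T :: real
  assume a: "\<forall>n\<in>{1..N}. a n \<ge> 0" and T: "T > 0"
  define F where "F t = cmod (\<Sum>n=1..N. complex_of_real (a n) * exp (\<i> * complex_of_real t * complex_of_real (\<phi> n)))" for t
  \<comment> \<open>The lower bound for the mean of \<open>F\<^sup>2\<close> over the interval.
    Taking the tangent at this bound, not at the mean itself, yields \<open>y ^ q\<close> directly,
    hence the factor \<open>(1 / 2) ^ q\<close>.\<close>
  define y where "y = (\<Sum>n=1..N. (a n)\<^sup>2) / 2"
  have y: "y \<ge> 0"
    by (simp add: y_def sum_nonneg)
  obtain k where k: "q = Suc k"
    using assms by (cases q) auto
  \<comment> \<open>The slope at \<open>y\<close> of the \<open>q\<close>-th power. Since it is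
    non-negative, the surplus of the mean over \<open>y\<close> can only help.\<close>
  define L where "L = real q * y ^ k"
  have L: "L \<ge> 0"
    using y by (simp add: L_def)
  have cont: "continuous_on S F" for S
    unfolding F_def by (intro continuous_intros)
  have sq: "(\<lambda>t. (F t)\<^sup>2) integrable_on {-T..T}"
    by (intro integrable_continuous_real continuous_intros cont)
  have mean: "2 * T * y \<le> integral {-T..T} (\<lambda>t. (F t)\<^sup>2)"
    unfolding F_def y_def using integral_norm_exp_sum_square_ge[of "{1..N}" a T \<phi>] a T by simp
  have "2 * T * y ^ q \<le> 2 * T * y ^ q + L * (integral {-T..T} (\<lambda>t. (F t)\<^sup>2) - 2 * T * y)"
    using L mean by simp
  also have "\<dots> = integral {-T..T} (\<lambda>t. y ^ q + L * ((F t)\<^sup>2 - y))"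
  proof -
    have const: "((\<lambda>_. c) has_integral 2 * T * c) {-T..T}" for c :: real
      using has_integral_const_real[of c "-T" T] T by (simp only: measure_lborel_Icc) simp
    have "((\<lambda>t. y ^ q + L * ((F t)\<^sup>2 - y)) has_integral
        2 * T * y ^ q + L * (integral {-T..T} (\<lambda>t. (F t)\<^sup>2) - 2 * T * y)) {-T..T}"
      by (intro has_integral_add has_integral_mult_right has_integral_diff const
          integrable_integral[OF sq])
    then show ?thesis
      by (simp add: integral_unique)
  qed
  \<comment> \<open>The tangent inequality is applied pointwise with
    \<open>x = (F t)\<^sup>2\<close>.\<close>
  also have "\<dots> \<le> integral {-T..T} (\<lambda>t. F t ^ (2 * q))"
  proof (intro integral_le integrable_continuous_real continuous_intros cont)
    show "y ^ q + L * ((F t)\<^sup>2 - y) \<le> F t ^ (2 * q)" for t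
      using power_ge_tangent[of "(F t)\<^sup>2" y k] y by (simp only: L_def k power_mult zero_le_power2)
  qed
  \<comment> \<open>Continuity of \<open>F\<close> on the compact interval makes the gauge and
    Lebesgue integrals agree.\<close>
  also have "\<dots> = (LINT t:{-T..T}|lborel. F t ^ (2 * q))"
    by (intro set_borel_integral_eq_integral(2)[symmetric] borel_integrable_atLeastAtMost'
        continuous_intros cont)
  finally have "y ^ q \<le> 1 / (2 * T) * (LINT t:{-T..T}|lborel. F t ^ (2 * q))"
    using T by (simp add: field_simps)
  then show "(1 / 2) ^ q * (\<Sum>n=1..N. (a n)\<^sup>2) ^ q \<le> 1 / (2 * T) *
      (LINT t:{-T..T}|lborel.
        (cmod (\<Sum>n=1..N. complex_of_real (a n) * exp (\<i> * complex_of_real t * complex_of_real (\<phi> n)))) ^ (2 * q))"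
    by (simp add: F_def y_def power_divide)
qed simp

end
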